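(* Let $\mathcal A$ be a set and let $\ell:\mathcal A\times\{0,1\}\to[0,1]$ be such that for every $p\in[0,1]$ a best response is attained, and fix a choice $k_\ell(p)\in\operatorname{arg\,min}_{a\in\mathcal A}L^\ell_p(a)$. Define the negative Bayes envelope $F_\ell(p)=-\min_{a\in\mathcal A}L_p^\ell(a)$ for $p\in[0,1]$. Then $$F_\ell(p)=\sup_{a\in\mathcal A}\{p\,s_\ell(a)-\ell(a,0)\}.$$ Let $F_\ell^*(s)=\sup_{q\in[0,1]}\{qs-F_\ell(q)\}$, $\mathcal S_\ell=\{s_\ell(a):a\in\mathcal A\}$ and, for $s\in\mathcal S_\ell$, $Q_\ell(s)=\operatorname{arg\,max}_{q\in[0,1]}\{qs-F_\ell(q)\}$. The set $Q_\ell(s)$ is nonempty. Define $$\mathcal R_\ell=\{(q,s):s\in\mathcal S_\ell,\ q\in Q_\ell(s)\},\qquad \lambda_\ell((q,s),y)=F_\ell^*(s)-sy,$$ and, for every $p\in[0,1]$, $s_{\ell,p}=s_\ell(k_\ell(p))$ and $\tau_\ell(p)=(p,s_{\ell,p})$. Then $\tau_\ell(p)\in\mathcal R_\ell$ and: (i) $\lambda_\ell:\mathcal R_\ell\times\{0,1\}\to\mathbb R$ is a $[0,1]$-valued proper loss with truth embedding $\tau_\ell$. (ii) $\lambda_\ell(\tau_\ell(p),y)=\ell(k_\ell(p),y)$ for all $p\in[0,1]$, $y\in\{0,1\}$. (iii) For every action $a\in\mathcal A$ and every choice $q_\ell(a)\in Q_\ell(s_\ell(a))$, setting $\rho_\ell(a)=(q_\ell(a),s_\ell(a))$,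 one has $\lambda_\ell(\rho_\ell(a),y)\le\ell(a,y)$ for all $y\in\{0,1\}$.
   Context: For $\ell:\mathcal A\times\{0,1\}\to[0,1]$ write $$L_p^\ell(a)=(1-p)\ell(a,0)+p\,\ell(a,1),\qquad \Delta_\ell(a)=\ell(a,1)-\ell(a,0),\qquad s_\ell(a)=-\Delta_\ell(a).$$ Proper loss with redundant messages: for a message space $\mathcal R$ and $\lambda:\mathcal R\times\{0,1\}\to[0,1]$, $\lambda$ is proper with truth embedding $\tau:[0,1]\to\mathcal R$ if for every $p\in[0,1]$ and $r\in\mathcal R$, $\mathbb E_{Y\sim\mathrm{Ber}(p)}[\lambda(\tau(p),Y)]\le\mathbb E_{Y\sim\mathrm{Ber}(p)}[\lambda(r,Y)]$. *)

theory Defs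
  imports "HOL-Probability.Probability"
begin

text \<open>
  The outcome space \<open>{0,1}\<close> is rendered as \<^typ>\<open>bool\<close>, with \<^const>\<open>False\<close> for \<open>0\<close> and
  \<^const>\<open>True\<close> for \<open>1\<close>; this is also the sample space of \<^const>\<open>bernoulli_pmf\<close>.
  Action and message spaces are explicit sets, and only values on these sets matter.
\<close>

definition unit_loss :: "'a set \<Rightarrow> ('a \<Rightarrow> bool \<Rightarrow> real) \<Rightarrow> bool" where
  "unit_loss A l \<longleftrightarrow> (\<forall>a\<in>A. \<forall>y. l a y \<in> {0..1})"

definition cond_loss :: "('a \<Rightarrow> bool \<Rightarrow> real) \<Rightarrow> real \<Rightarrow> 'a \<Rightarrow> real" where
  "cond_loss l p a = (1 - p) * l a False + p * l a True"

definition loss_diff :: "('a \<Rightarrow> bool \<Rightarrow> real) \<Rightarrow> 'a \<Rightarrow> real" where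
  "loss_diff l a = l a True - l a False"

definition slope :: "('a \<Rightarrow> bool \<Rightarrow> real) \<Rightarrow> 'a \<Rightarrow> real" where
  "slope l a = - loss_diff l a"

definition proper_loss ::
    "'r set \<Rightarrow> ('r \<Rightarrow> bool \<Rightarrow> real) \<Rightarrow> (real \<Rightarrow> 'r) \<Rightarrow> bool" where
  "proper_loss R lam \<tau> \<longleftrightarrow>
     unit_loss R lam \<and>
     (\<forall>p\<in>{0..1}. \<tau> p \<in> R) \<and>
     (\<forall>p\<in>{0..1}. \<forall>r\<in>R.
        measure_pmf.expectation (bernoulli_pmf p) (lam (\<tau> p))
          \<le> measure_pmf.expectation (bernoulli_pmf p) (lam r))"

text \<open>
  The minimum over a possibly infinite action set is the least element of the set of
  attained values; it is meaningful only when a best response exists.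
\<close>

definition neg_bayes :: "'a set \<Rightarrow> ('a \<Rightarrow> bool \<Rightarrow> real) \<Rightarrow> real \<Rightarrow> real" where
  "neg_bayes A l p = - (LEAST v. v \<in> cond_loss l p ` A)"

text \<open>
  The real-valued supremum below is a genuine one whenever the loss is \<open>[0,1]\<close>-valued and
  best responses exist: the envelope then takes values in \<open>[-1,0]\<close> on \<open>[0,1]\<close>.
\<close>

definition neg_bayes_conj :: "'a set \<Rightarrow> ('a \<Rightarrow> bool \<Rightarrow> real) \<Rightarrow> real \<Rightarrow> real" where
  "neg_bayes_conj A l s = (SUP q\<in>{0..1}. q * s - neg_bayes A l q)"

definition slopes :: "'a set \<Rightarrow> ('a \<Rightarrow> bool \<Rightarrow> real) \<Rightarrow> real set" where
  "slopes A l = slope l ` A"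

definition conj_argmax :: "'a set \<Rightarrow> ('a \<Rightarrow> bool \<Rightarrow> real) \<Rightarrow> real \<Rightarrow> real set" where
  "conj_argmax A l s =
     {q. is_arg_max (\<lambda>q. q * s - neg_bayes A l q) (\<lambda>q. q \<in> {0..1}) q}"

definition messages :: "'a set \<Rightarrow> ('a \<Rightarrow> bool \<Rightarrow> real) \<Rightarrow> (real \<times> real) set" where
  "messages A l = {(q, s). s \<in> slopes A l \<and> q \<in> conj_argmax A l s}"

definition message_loss ::
    "'a set \<Rightarrow> ('a \<Rightarrow> bool \<Rightarrow> real) \<Rightarrow> real \<times> real \<Rightarrow> bool \<Rightarrow> real" where
  "message_loss A l = (\<lambda>(q, s) y. neg_bayes_conj A l s - s * of_bool y)"

definition truth_emb ::
    "('a \<Rightarrow> bool \<Rightarrow> real) \<Rightarrow> (real \<Rightarrow> 'a) \<Rightarrow> real \<Rightarrow> real \<times> real" where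
  "truth_emb l k p = (p, slope l (k p))"

end

theory Submission
  imports Defs
begin

text \<open>
  Each action \<open>a\<close> contributes the affine function \<open>p \<mapsto> p s(a) - l(a,0)\<close>, and \<open>F\<close> is the pointwise
  maximum of these, attained at \<open>p\<close> by the best response \<open>k(p)\<close>. Hence \<open>F\<^sup>*(s(a)) \<le> l(a,0)\<close>, with
  equality when \<open>a = k(p)\<close>, so replacing \<open>l(a,0)\<close> by \<open>F\<^sup>*(s(a))\<close> only lowers the
  loss and changes nothing at best responses. Properness is the Fenchel--Young inequality
  \<open>F\<^sup>*(s) - s p \<ge> - F(p)\<close>. The argmax sets are nonempty because the slopes lie in \<open>[-1,1]\<close>,
  which makes \<open>F\<close> Lipschitz on \<open>[0,1]\<close>.
\<close>

lemma cond_loss_eq_slope: "cond_loss l p a = l a False - p * slope l a"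
  by (simp add: cond_loss_def slope_def loss_diff_def algebra_simps)

lemma loss_True_eq_slope: "l a True = l a False - slope l a"
  by (simp add: slope_def loss_diff_def)

lemma abs_slope_le_1:
  assumes "unit_loss A l" "a \<in> A"
  shows "\<bar>slope l a\<bar> \<le> 1"
proof -
  have "l a False \<in> {0..1}" "l a True \<in> {0..1}"
    using assms unfolding unit_loss_def by blast+
  then show ?thesis by (auto simp: slope_def loss_diff_def abs_le_iff)
qed

text \<open>The reals are not well-ordered, so \<open>LEAST\<close> carries information only once a
  least element is exhibited; the minimiser supplies it.\<close>

lemma neg_bayes_eq_arg_min:
  assumes "is_arg_min (cond_loss l p) (\<lambda>a. a \<in> A) a"
  shows "neg_bayes A l p = p * slope l a - l a False"
proof -
  have "(LEAST v. v \<in> cond_loss l p ` A) = cond_loss l p a"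
    by (rule Least_equality) (use assms in \<open>auto simp: is_arg_min_linorder\<close>)
  then show ?thesis by (simp add: neg_bayes_def cond_loss_eq_slope)
qed

locale attained_loss =
  fixes A :: "'a set" and l :: "'a \<Rightarrow> bool \<Rightarrow> real" and k :: "real \<Rightarrow> 'a"
  assumes unit_loss: "unit_loss A l"
    and best: "p \<in> {0..1} \<Longrightarrow> is_arg_min (cond_loss l p) (\<lambda>a. a \<in> A) (k p)"
begin

lemma best_in: "p \<in> {0..1} \<Longrightarrow> k p \<in> A"
  using best by (auto simp: is_arg_min_linorder)

lemma neg_bayes_best:
  "p \<in> {0..1} \<Longrightarrow> neg_bayes A l p = p * slope l (k p) - l (k p) False"
  by (intro neg_bayes_eq_arg_min best)

lemma neg_bayes_ge:
  assumes "p \<in> {0..1}" "a \<in> A"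
  shows "p * slope l a - l a False \<le> neg_bayes A l p"
proof -
  have "cond_loss l p (k p) \<le> cond_loss l p a"
    using best[OF assms(1)] assms(2) by (simp add: is_arg_min_linorder)
  then show ?thesis
    by (simp add: neg_bayes_best[OF assms(1)] cond_loss_eq_slope)
qed

lemma neg_bayes_eq_SUP:
  assumes "p \<in> {0..1}"
  shows "neg_bayes A l p = (SUP a\<in>A. p * slope l a - l a False)"
proof (rule cSup_eq_maximum[symmetric])
  show "neg_bayes A l p \<in> (\<lambda>a. p * slope l a - l a False) ` A"
    using neg_bayes_best best_in assms by blast
qed (use neg_bayes_ge assms in blast)

lemma neg_bayes_lipschitz: "1-lipschitz_on {0..1} (neg_bayes A l)"
proof (rule lipschitz_onI)
  have le: "neg_bayes A l p - neg_bayes A l q \<le> \<bar>p - q\<bar>" if pq: "p \<in> {0..1}" "q \<in> {0..1}" for p q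
  proof -
    \<comment> \<open>The affine function of the action \<open>k p\<close> equals the envelope at
      \<open>p\<close> and lies below it at \<open>q\<close>, so its slope is a subgradient at
      \<open>p\<close>.\<close>
    have "neg_bayes A l p - neg_bayes A l q \<le> (p - q) * slope l (k p)"
      using neg_bayes_best[OF pq(1)] neg_bayes_ge[OF pq(2) best_in[OF pq(1)]]
      by (simp add: algebra_simps)
    also have "\<dots> \<le> \<bar>p - q\<bar> * \<bar>slope l (k p)\<bar>"
      by (metis abs_ge_self abs_mult)
    also have "\<dots> \<le> \<bar>p - q\<bar>"
      using abs_slope_le_1[OF unit_loss best_in[OF pq(1)]] by (simp add: mult_left_le)
    finally show ?thesis .
  qed
  fix p q :: real assume "p \<in> {0..1}" "q \<in> {0..1}"
  then show "dist (neg_bayes A l p) (neg_bayes A l q) \<le> 1 * dist p q"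
    using le[of p q] le[of q p] by (simp add: dist_real_def abs_le_iff abs_minus_commute)
qed simp

text \<open>Convexity alone leaves continuity at the endpoints 0 and 1 open; the Lipschitz bound
  covers them, and compactness of the interval gives a maximiser for every real
  \<open>s\<close>.\<close>

lemma conj_argmax_nonempty: "conj_argmax A l s \<noteq> {}"
proof -
  have "continuous_on {0..1} (\<lambda>q. q * s - neg_bayes A l q)"
    by (intro continuous_intros lipschitz_on_continuous_on[OF neg_bayes_lipschitz])
  then have "\<exists>q\<in>{0..1}. \<forall>x\<in>{0..1}. x * s - neg_bayes A l x \<le> q * s - neg_bayes A l q"
    by (intro continuous_attains_sup) simp_all
  then obtain q where "q \<in> {0..1}"
    "\<forall>x\<in>{0..1}. x * s - neg_bayes A l x \<le> q * s - neg_bayes A l q"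
    by (elim bexE)
  then have "q \<in> conj_argmax A l s"
    by (auto simp: conj_argmax_def is_arg_max_linorder)
  then show ?thesis by blast
qed

lemma neg_bayes_conj_eq:
  assumes "q \<in> conj_argmax A l s"
  shows "neg_bayes_conj A l s = q * s - neg_bayes A l q"
  unfolding neg_bayes_conj_def
  by (rule cSup_eq_maximum) (use assms in \<open>auto simp: conj_argmax_def is_arg_max_linorder\<close>)

text \<open>Comparing \<open>p\<close> with a maximiser \<open>q\<close>, where the
  \<open>SUP\<close> is known to be attained, avoids a separate proof that its range is bounded
  above.\<close>

lemma fenchel_young:
  assumes "p \<in> {0..1}"
  shows "p * s \<le> neg_bayes A l p + neg_bayes_conj A l s"
proof -
  obtain q where q: "q \<in> conj_argmax A l s"
    using conj_argmax_nonempty by blast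
  then have "p * s - neg_bayes A l p \<le> q * s - neg_bayes A l q"
    using assms by (auto simp: conj_argmax_def is_arg_max_linorder)
  with neg_bayes_conj_eq[OF q] show ?thesis by simp
qed

lemma neg_bayes_conj_slope_le:
  assumes "a \<in> A"
  shows "neg_bayes_conj A l (slope l a) \<le> l a False"
  unfolding neg_bayes_conj_def
proof (rule cSUP_least)
  show "q * slope l a - neg_bayes A l q \<le> l a False" if "q \<in> {0..1}" for q
    using neg_bayes_ge[OF that assms] by simp
qed simp

text \<open>The lower bound is Fenchel-Young at \<open>p\<close>, where the envelope coincides with
  the affine function of \<open>k p\<close>.\<close>

lemma neg_bayes_conj_slope_best:
  assumes "p \<in> {0..1}"
  shows "neg_bayes_conj A l (slope l (k p)) = l (k p) False"
  using neg_bayes_conj_slope_le[OF best_in[OF assms]] neg_bayes_best[OF assms]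
    fenchel_young[OF assms, of "slope l (k p)"] by simp

text \<open>Passing from outcome 0 to outcome 1 subtracts \<open>slope l a\<close> on both sides, so
  the bound at outcome 0 settles both cases.\<close>

lemma message_loss_le:
  assumes "a \<in> A"
  shows "message_loss A l (q, slope l a) y \<le> l a y"
  using neg_bayes_conj_slope_le[OF assms]
  by (cases y) (simp_all add: message_loss_def loss_True_eq_slope)

text \<open>An outcome \<open>y\<close> is the Bernoulli law with \<open>p = of_bool y\<close>.
  Fenchel-Young at this \<open>p\<close> bounds the loss below by \<open>- neg_bayes A l p\<close>,
  a minimal expected loss and hence nonnegative.\<close>

lemma message_loss_nonneg: "0 \<le> message_loss A l (q, s) y"
proof -
  have *: "neg_bayes A l p \<le> 0" if "p \<in> {0..1}" for p
  proof -
    have "l (k p) False \<in> {0..1}" "l (k p) True \<in> {0..1}"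
      using unit_loss best_in[OF that] unfolding unit_loss_def by blast+
    then have "0 \<le> cond_loss l p (k p)"
      using that by (simp add: cond_loss_def)
    then show ?thesis
      by (simp add: neg_bayes_best[OF that] cond_loss_eq_slope)
  qed
  show ?thesis
    using *[of "of_bool y"] fenchel_young[of "of_bool y" s]
    by (cases y) (simp_all add: message_loss_def)
qed

lemma unit_loss_message_loss: "unit_loss (messages A l) (message_loss A l)"
proof -
  \<comment> \<open>The slope in a message always comes from some action, whose own loss is at most
    1 and dominates.\<close>
  have "message_loss A l (q, slope l a) y \<le> 1" if "a \<in> A" for q a y
  proof -
    have "l a y \<in> {0..1}"
      using unit_loss that unfolding unit_loss_def by blast
    then show ?thesis using message_loss_le[OF that, of q y] by simp
  qed
  then show ?thesis
    using message_loss_nonneg by (auto simp: unit_loss_def messages_def slopes_def)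
qed

text \<open>Since \<open>k p\<close> supports the envelope at \<open>p\<close>, the objective with
  slope \<open>slope l (k p)\<close> never exceeds \<open>l (k p) False\<close> and reaches it at
  \<open>p\<close>.\<close>

lemma truth_emb_in_messages:
  assumes "p \<in> {0..1}"
  shows "truth_emb l k p \<in> messages A l"
proof -
  have "q * slope l (k p) - neg_bayes A l q \<le> p * slope l (k p) - neg_bayes A l p"
    if "q \<in> {0..1}" for q
    using neg_bayes_ge[OF that best_in[OF assms]] neg_bayes_best[OF assms] by simp
  then have "p \<in> conj_argmax A l (slope l (k p))"
    using assms by (auto simp: conj_argmax_def is_arg_max_linorder)
  then show ?thesis
    using best_in[OF assms] by (simp add: truth_emb_def messages_def slopes_def)
qed

lemma message_loss_truth_emb:
  assumes "p \<in> {0..1}"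
  shows "message_loss A l (truth_emb l k p) y = l (k p) y"
  by (cases y) (simp_all add: message_loss_def truth_emb_def loss_True_eq_slope
      neg_bayes_conj_slope_best[OF assms])

text \<open>The loss is affine in the outcome, so its expectation is its value at the mean
  \<open>p\<close>.\<close>

lemma expectation_message_loss:
  assumes "p \<in> {0..1}"
  shows "measure_pmf.expectation (bernoulli_pmf p) (message_loss A l (q, s))
    = neg_bayes_conj A l s - p * s"
  using assms by (simp add: message_loss_def algebra_simps)

lemma proper_loss_message_loss:
  "proper_loss (messages A l) (message_loss A l) (truth_emb l k)"
proof -
  have "measure_pmf.expectation (bernoulli_pmf p) (message_loss A l (truth_emb l k p))
      \<le> measure_pmf.expectation (bernoulli_pmf p) (message_loss A l (q, s))"
    if p: "p \<in> {0..1}" for p q s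
    \<comment> \<open>The truthful message has expected loss exactly
      \<open>- neg_bayes A l p\<close>, the Fenchel-Young lower bound for all messages.\<close>
    using fenchel_young[OF p, of s] neg_bayes_best[OF p]
    by (simp add: truth_emb_def expectation_message_loss[OF p] neg_bayes_conj_slope_best[OF p])
  then show ?thesis
    using unit_loss_message_loss truth_emb_in_messages by (auto simp only: proper_loss_def)
qed

end

theorem lemma7p2:
  fixes A :: "'a set" and l :: "'a \<Rightarrow> bool \<Rightarrow> real" and k :: "real \<Rightarrow> 'a"
  assumes loss: "unit_loss A l"
    and attained: "\<forall>p\<in>{0..1}. \<exists>a. is_arg_min (cond_loss l p) (\<lambda>a. a \<in> A) a"
    and choice: "\<forall>p\<in>{0..1}. is_arg_min (cond_loss l p) (\<lambda>a. a \<in> A) (k p)"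
  shows
    "(\<forall>p\<in>{0..1}. neg_bayes A l p = (SUP a\<in>A. p * slope l a - l a False)) \<and>
     (\<forall>s\<in>slopes A l. conj_argmax A l s \<noteq> {}) \<and>
     (\<forall>p\<in>{0..1}. truth_emb l k p \<in> messages A l) \<and>
     proper_loss (messages A l) (message_loss A l) (truth_emb l k) \<and>
     (\<forall>p\<in>{0..1}. \<forall>y. message_loss A l (truth_emb l k p) y = l (k p) y) \<and>
     (\<forall>a\<in>A. \<forall>q\<in>conj_argmax A l (slope l a). \<forall>y.
        message_loss A l (q, slope l a) y \<le> l a y)"
proof -
  interpret attained_loss A l k
    using loss choice by unfold_locales auto
  show ?thesis
    by (intro conjI ballI allI neg_bayes_eq_SUP conj_argmax_nonempty truth_emb_in_messages
        proper_loss_message_loss message_loss_truth_emb message_loss_le)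
qed

end
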